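(* Let $\mathcal{A}$ be a Banach algebra and let $\varphi\in\mathcal{A}^{*}$. The following are equivalent: (1) $\varphi$ is right Asplund, i.e. $\varphi\circledast B_{\mathcal{A}}$ is a fragmented family of functions over $(B_{\mathcal{A}^{**}},w^{*})$; (2) the orbit map $\mathcal{O}_{\varphi}^{(l)}$ is (weak-star, norm) fragmented over $B_{\mathcal{A}^{**}}$; (3) the family of maps $\{\boxdot_{\nu}^{(r)}\}_{\nu\in B_{\mathcal{A}^{**}}}$ is (weak-star, $\rho_{\varphi}$) fragmented over $B_{\mathcal{A}^{**}}$. Analogously, the following are equivalent: (1') $\varphi$ is left Asplund, i.e. $B_{\mathcal{A}}\circledast\varphi$ is a fragmented family of functions over $(B_{\mathcal{A}^{**}},w^{*})$; (2') the orbit map $\mathcal{O}_{\varphi}^{(r)}$ is (weak-star, norm) fragmented over $B_{\mathcal{A}^{**}}$; (3') the family of maps $\{\diamond_{\nu}^{(l)}\}_{\nu\in B_{\mathcal{A}^{**}}}$ is (weak-star, $\rho_{\varphi}$) fragmented over $B_{\mathcal{A}^{**}}$.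
   Context: All vector spaces are over $\mathbb{R}$; $B_{V}$ is the closed unit ball of a Banach space $V$. For $a,b\in\mathcal{A}$, $\varphi\in\mathcal{A}^{*}$: $\langle a\circledast\varphi,b\rangle:=\langle\varphi,ba\rangle$ and $\langle\varphi\circledast a,b\rangle:=\langle\varphi,ab\rangle$. For $\mu\in\mathcal{A}^{**}$: $\langle\mu\circledast\varphi,b\rangle:=\langle\mu,\varphi\circledast b\rangle$ and $\langle\varphi\circledast\mu,b\rangle:=\langle\mu,b\circledast\varphi\rangle$. The Arens products on $\mathcal{A}^{**}$ are $\langle\mu\boxdot\nu,\varphi\rangle:=\langle\mu,\nu\circledast\varphi\rangle$ and $\langle\mu\diamond\nu,\varphi\rangle:=\langle\nu,\varphi\circledast\mu\rangle$. Set $\mathcal{O}_{\varphi}^{(l)}(\mu):=\mu\circledast\varphi$, $\mathcal{O}_{\varphi}^{(r)}(\mu):=\varphi\circledast\mu$ (maps $\mathcal{A}^{**}\to\mathcal{A}^{*}$), $\boxdot_{\nu}^{(r)}(\mu):=\nu\boxdot\mu$ and $\diamond_{\nu}^{(l)}(\mu):=\mu\diamond\nu$ (maps $\mathcal{A}^{**}\to\mathcal{A}^{**}$). $\rho_{\varphi}(\mu)=|\langle\mu,\varphi\rangle|$ is a seminorm on $\mathcal{A}^{**}$. For sets, $B_{\mathcal{A}}\circledast\varphi=\{a\circledast\varphi: a\in B_{\mathcal{A}}\}$ and $\varphi\circledast B_{\mathcal{A}}=\{\varphi\circledast a: a\in B_{\mathcal{A}}\}$; their elements are viewed as real functions on $B_{\mathcal{A}^{**}}$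 by evaluation. Fragmentability. Let $X$ be a topological space and $(M,d)$ a (pseudo)metric space. A map $f\colon X\to M$ is fragmented if for every nonempty $A\subseteq X$ and $\varepsilon>0$ there is an open $O\subseteq X$ with $O\cap A\neq\emptyset$ and $\mathrm{diam}_{d}f(O\cap A)<\varepsilon$. A family of maps $X\to M$ is a fragmented family if for all such $A,\varepsilon$ one can choose a single $O$ that works simultaneously for all maps of the family. "(weak-star, norm) fragmented over $B_{\mathcal{A}^{**}}$" means that the restriction to $X=(B_{\mathcal{A}^{**}},w^{*})$ is fragmented with respect to the norm metric on the target; "(weak-star, $\rho_{\varphi}$) fragmented" uses the pseudometric $\rho_{\varphi}(\mu-\kappa)$ on the target. $\varphi$ is right (left) Asplund if $\varphi\circledast B_{\mathcal{A}}$ (respectively $B_{\mathcal{A}}\circledast\varphi$) is an Asplund subset of $\mathcal{A}^{*}$, where a bounded subset $C$ of a Banach space $V$ is Asplund if it is a fragmented family of functions on $(B_{V^{*}},w^{*})$. *)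

theory Defs
  imports "HOL-Analysis.Analysis"
begin

section \<open>Duals and the weak-star topology\<close>

type_synonym 'a dual = "('a, real) blinfun"
type_synonym 'a bidual = "(('a, real) blinfun, real) blinfun"

text \<open>The library's topology of pointwise convergence on bounded linear maps is,
  for real-valued maps, the weak-star topology of the dual.\<close>

abbreviation weak_star :: "('v::real_normed_vector) dual topology" where
  "weak_star \<equiv> strong_operator_topology"

definition weak_star_ball :: "('v::real_normed_vector) dual topology" where
  "weak_star_ball = subtopology weak_star (cball 0 1)"


section \<open>Fragmentability\<close>

text \<open>The diameter takes values in \<^typ>\<open>ennreal\<close>, so that it is infinite on unbounded sets
  (the supremum in \<^typ>\<open>real\<close> of an unbounded set is unspecified), and 0 on the empty set.
  The pseudometric \<open>d\<close> on the target is a parameter; the target is a whole type.\<close>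

definition pdiam :: "('m \<Rightarrow> 'm \<Rightarrow> real) \<Rightarrow> 'm set \<Rightarrow> ennreal" where
  "pdiam d S = (SUP x\<in>S. SUP y\<in>S. ennreal (d x y))"

definition fragmented :: "'x topology \<Rightarrow> ('m \<Rightarrow> 'm \<Rightarrow> real) \<Rightarrow> ('x \<Rightarrow> 'm) \<Rightarrow> bool" where
  "fragmented X d f \<longleftrightarrow>
    (\<forall>A \<epsilon>. A \<subseteq> topspace X \<and> A \<noteq> {} \<and> \<epsilon> > 0 \<longrightarrow>
      (\<exists>U. openin X U \<and> U \<inter> A \<noteq> {} \<and> pdiam d (f ` (U \<inter> A)) < ennreal \<epsilon>))"

definition fragmented_family :: "'x topology \<Rightarrow> ('m \<Rightarrow> 'm \<Rightarrow> real) \<Rightarrow> ('x \<Rightarrow> 'm) set \<Rightarrow> bool" where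
  "fragmented_family X d F \<longleftrightarrow>
    (\<forall>A \<epsilon>. A \<subseteq> topspace X \<and> A \<noteq> {} \<and> \<epsilon> > 0 \<longrightarrow>
      (\<exists>U. openin X U \<and> U \<inter> A \<noteq> {} \<and> (\<forall>f\<in>F. pdiam d (f ` (U \<inter> A)) < ennreal \<epsilon>)))"

definition asplund_set :: "('v::banach) set \<Rightarrow> bool" where
  "asplund_set C \<longleftrightarrow>
    bounded C \<and>
    fragmented_family (weak_star_ball :: 'v dual topology) dist ((\<lambda>v x. blinfun_apply x v) ` C)"


section \<open>Module actions and Arens products\<close>

text \<open>The four meanings of \<open>\<circledast>\<close> are kept apart by name:
  \<open>act_l a \<phi>\<close> is \<open>a \<circledast> \<phi>\<close>, \<open>act_r \<phi> a\<close> is \<open>\<phi> \<circledast> a\<close>,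
  \<open>biact_l \<mu> \<phi>\<close> is \<open>\<mu> \<circledast> \<phi>\<close> and \<open>biact_r \<phi> \<mu>\<close> is \<open>\<phi> \<circledast> \<mu>\<close>,
  for \<open>a\<close> in the algebra, \<open>\<phi>\<close> in its dual and \<open>\<mu>\<close> in its bidual.
  The functions under \<^const>\<open>Blinfun\<close> are bounded linear, as the evaluation lemmas show.\<close>

definition act_l :: "'a::real_normed_algebra \<Rightarrow> 'a dual \<Rightarrow> 'a dual" where
  "act_l a \<phi> = Blinfun (\<lambda>b. blinfun_apply \<phi> (b * a))"

definition act_r :: "'a::real_normed_algebra dual \<Rightarrow> 'a \<Rightarrow> 'a dual" where
  "act_r \<phi> a = Blinfun (\<lambda>b. blinfun_apply \<phi> (a * b))"

lemma act_l_apply [simp]: "blinfun_apply (act_l a \<phi>) b = blinfun_apply \<phi> (b * a)"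
  unfolding act_l_def
  by (subst bounded_linear_Blinfun_apply)
    (auto intro!: bounded_linear_blinfun_apply bounded_linear_mult_left)

lemma act_r_apply [simp]: "blinfun_apply (act_r \<phi> a) b = blinfun_apply \<phi> (a * b)"
  unfolding act_r_def
  by (subst bounded_linear_Blinfun_apply)
    (auto intro!: bounded_linear_blinfun_apply bounded_linear_mult_right)

lemma norm_act_l_le: "norm (act_l a \<phi>) \<le> norm a * norm \<phi>"
proof (rule norm_blinfun_bound)
  fix b
  have "norm (blinfun_apply \<phi> (b * a)) \<le> norm \<phi> * norm (b * a)" by (rule norm_blinfun)
  also have "\<dots> \<le> norm \<phi> * (norm b * norm a)"
    by (intro mult_left_mono norm_mult_ineq norm_ge_zero)
  finally show "norm (blinfun_apply (act_l a \<phi>) b) \<le> norm a * norm \<phi> * norm b"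
    by (simp add: algebra_simps)
qed simp

lemma norm_act_r_le: "norm (act_r \<phi> a) \<le> norm \<phi> * norm a"
proof (rule norm_blinfun_bound)
  fix b
  have "norm (blinfun_apply \<phi> (a * b)) \<le> norm \<phi> * norm (a * b)" by (rule norm_blinfun)
  also have "\<dots> \<le> norm \<phi> * (norm a * norm b)"
    by (intro mult_left_mono norm_mult_ineq norm_ge_zero)
  finally show "norm (blinfun_apply (act_r \<phi> a) b) \<le> norm \<phi> * norm a * norm b"
    by (simp add: algebra_simps)
qed simp

lemma bounded_bilinear_act_l: "bounded_bilinear act_l"
  by standard
    (auto intro!: blinfun_eqI exI[where x = 1]
      simp: blinfun.bilinear_simps distrib_left distrib_right norm_act_l_le)

lemma bounded_bilinear_act_r: "bounded_bilinear act_r"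
  by standard
    (auto intro!: blinfun_eqI exI[where x = 1]
      simp: blinfun.bilinear_simps distrib_left distrib_right norm_act_r_le)

definition biact_l :: "'a::real_normed_algebra bidual \<Rightarrow> 'a dual \<Rightarrow> 'a dual" where
  "biact_l \<mu> \<phi> = Blinfun (\<lambda>b. blinfun_apply \<mu> (act_r \<phi> b))"

definition biact_r :: "'a::real_normed_algebra dual \<Rightarrow> 'a bidual \<Rightarrow> 'a dual" where
  "biact_r \<phi> \<mu> = Blinfun (\<lambda>b. blinfun_apply \<mu> (act_l b \<phi>))"

lemma biact_l_apply [simp]: "blinfun_apply (biact_l \<mu> \<phi>) b = blinfun_apply \<mu> (act_r \<phi> b)"
  unfolding biact_l_def
  by (subst bounded_linear_Blinfun_apply)
    (auto intro!: bounded_linear_blinfun_apply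
      bounded_bilinear.bounded_linear_right[OF bounded_bilinear_act_r])

lemma biact_r_apply [simp]: "blinfun_apply (biact_r \<phi> \<mu>) b = blinfun_apply \<mu> (act_l b \<phi>)"
  unfolding biact_r_def
  by (subst bounded_linear_Blinfun_apply)
    (auto intro!: bounded_linear_blinfun_apply
      bounded_bilinear.bounded_linear_left[OF bounded_bilinear_act_l])

lemma norm_biact_l_le: "norm (biact_l \<mu> \<phi>) \<le> norm \<mu> * norm \<phi>"
proof (rule norm_blinfun_bound)
  fix b
  have "norm (blinfun_apply \<mu> (act_r \<phi> b)) \<le> norm \<mu> * norm (act_r \<phi> b)" by (rule norm_blinfun)
  also have "\<dots> \<le> norm \<mu> * (norm \<phi> * norm b)"
    by (intro mult_left_mono norm_act_r_le norm_ge_zero)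
  finally show "norm (blinfun_apply (biact_l \<mu> \<phi>) b) \<le> norm \<mu> * norm \<phi> * norm b"
    by (simp add: algebra_simps)
qed simp

lemma norm_biact_r_le: "norm (biact_r \<phi> \<mu>) \<le> norm \<phi> * norm \<mu>"
proof (rule norm_blinfun_bound)
  fix b
  have "norm (blinfun_apply \<mu> (act_l b \<phi>)) \<le> norm \<mu> * norm (act_l b \<phi>)" by (rule norm_blinfun)
  also have "\<dots> \<le> norm \<mu> * (norm b * norm \<phi>)"
    by (intro mult_left_mono norm_act_l_le norm_ge_zero)
  finally show "norm (blinfun_apply (biact_r \<phi> \<mu>) b) \<le> norm \<phi> * norm \<mu> * norm b"
    by (simp add: algebra_simps)
qed simp

lemma bounded_bilinear_biact_l: "bounded_bilinear biact_l"
  by standard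
    (auto intro!: blinfun_eqI exI[where x = 1]
      simp: blinfun.bilinear_simps bounded_bilinear.add_left[OF bounded_bilinear_act_r]
        bounded_bilinear.scaleR_left[OF bounded_bilinear_act_r] norm_biact_l_le)

lemma bounded_bilinear_biact_r: "bounded_bilinear biact_r"
  by standard
    (auto intro!: blinfun_eqI exI[where x = 1]
      simp: blinfun.bilinear_simps bounded_bilinear.add_right[OF bounded_bilinear_act_l]
        bounded_bilinear.scaleR_right[OF bounded_bilinear_act_l] norm_biact_r_le)

text \<open>\<open>arens_box\<close> and \<open>arens_diamond\<close> are the first and the second Arens product.\<close>

definition arens_box :: "'a::real_normed_algebra bidual \<Rightarrow> 'a bidual \<Rightarrow> 'a bidual" where
  "arens_box \<mu> \<nu> = Blinfun (\<lambda>\<phi>. blinfun_apply \<mu> (biact_l \<nu> \<phi>))"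

definition arens_diamond :: "'a::real_normed_algebra bidual \<Rightarrow> 'a bidual \<Rightarrow> 'a bidual" where
  "arens_diamond \<mu> \<nu> = Blinfun (\<lambda>\<phi>. blinfun_apply \<nu> (biact_r \<phi> \<mu>))"

lemma arens_box_apply [simp]:
  "blinfun_apply (arens_box \<mu> \<nu>) \<phi> = blinfun_apply \<mu> (biact_l \<nu> \<phi>)"
  unfolding arens_box_def
  by (subst bounded_linear_Blinfun_apply)
    (auto intro!: bounded_linear_blinfun_apply
      bounded_bilinear.bounded_linear_right[OF bounded_bilinear_biact_l])

lemma arens_diamond_apply [simp]:
  "blinfun_apply (arens_diamond \<mu> \<nu>) \<phi> = blinfun_apply \<nu> (biact_r \<phi> \<mu>)"
  unfolding arens_diamond_def
  by (subst bounded_linear_Blinfun_apply)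
    (auto intro!: bounded_linear_blinfun_apply
      bounded_bilinear.bounded_linear_left[OF bounded_bilinear_biact_r])

definition orbit_l :: "'a::real_normed_algebra dual \<Rightarrow> 'a bidual \<Rightarrow> 'a dual" where
  "orbit_l \<phi> \<mu> = biact_l \<mu> \<phi>"

definition orbit_r :: "'a::real_normed_algebra dual \<Rightarrow> 'a bidual \<Rightarrow> 'a dual" where
  "orbit_r \<phi> \<mu> = biact_r \<phi> \<mu>"

definition box_r :: "'a::real_normed_algebra bidual \<Rightarrow> 'a bidual \<Rightarrow> 'a bidual" where
  "box_r \<nu> \<mu> = arens_box \<nu> \<mu>"

definition diamond_l :: "'a::real_normed_algebra bidual \<Rightarrow> 'a bidual \<Rightarrow> 'a bidual" where
  "diamond_l \<nu> \<mu> = arens_diamond \<mu> \<nu>"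

definition rho :: "'a::real_normed_vector dual \<Rightarrow> 'a bidual \<Rightarrow> real" where
  "rho \<phi> \<mu> = \<bar>blinfun_apply \<mu> \<phi>\<bar>"

definition rho_dist :: "'a::real_normed_vector dual \<Rightarrow> 'a bidual \<Rightarrow> 'a bidual \<Rightarrow> real" where
  "rho_dist \<phi> \<mu> \<kappa> = rho \<phi> (\<mu> - \<kappa>)"


section \<open>Asplund functionals\<close>

definition right_asplund :: "'a::real_normed_algebra dual \<Rightarrow> bool" where
  "right_asplund \<phi> \<longleftrightarrow> asplund_set ((\<lambda>a. act_r \<phi> a) ` cball 0 1)"

definition left_asplund :: "'a::real_normed_algebra dual \<Rightarrow> bool" where
  "left_asplund \<phi> \<longleftrightarrow> asplund_set ((\<lambda>a. act_l a \<phi>) ` cball 0 1)"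

text \<open>The boundedness required of an Asplund set is automatic here.\<close>

lemma right_asplund_iff:
  "right_asplund \<phi> \<longleftrightarrow>
    fragmented_family weak_star_ball dist ((\<lambda>a \<mu>. blinfun_apply \<mu> (act_r \<phi> a)) ` cball 0 1)"
proof -
  have "bounded (act_r \<phi> ` cball 0 1)"
    by (intro bounded_linear_image bounded_cball
        bounded_bilinear.bounded_linear_right[OF bounded_bilinear_act_r])
  then show ?thesis
    by (simp add: right_asplund_def asplund_set_def image_image)
qed

lemma left_asplund_iff:
  "left_asplund \<phi> \<longleftrightarrow>
    fragmented_family weak_star_ball dist ((\<lambda>a \<mu>. blinfun_apply \<mu> (act_l a \<phi>)) ` cball 0 1)"
proof -
  have "bounded ((\<lambda>a. act_l a \<phi>) ` cball 0 1)"
    by (intro bounded_linear_image bounded_cball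
        bounded_bilinear.bounded_linear_left[OF bounded_bilinear_act_l])
  then show ?thesis
    by (simp add: left_asplund_def asplund_set_def image_image)
qed

end

theory Submission
  imports Defs
begin

text \<open>Each of the two families is a norming family of seminorms composed with the orbit map:
  the elements of \<open>B\<^bsub>A\<^esub>\<close> and those of \<open>B\<^bsub>A**\<^esub>\<close> both compute the norm of \<open>A*\<close> as a supremum.
  A set has small diameter uniformly over a norming family exactly when it has small norm diameter,
  up to replacing \<open>\<epsilon>\<close> by \<open>\<epsilon>/2\<close> because suprema do not preserve strict inequalities. That points of
  \<open>B\<^bsub>A\<^esub>\<close> suffice to norm \<open>A*\<close> makes Hahn--Banach unnecessary.\<close>

lemma pdiam_le_iff: "pdiam d S \<le> c \<longleftrightarrow> (\<forall>x\<in>S. \<forall>y\<in>S. ennreal (d x y) \<le> c)"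
  by (simp add: pdiam_def SUP_le_iff)

lemma pdiam_image_mono:
  assumes "\<And>x y. e (g x) (g y) \<le> d (f x) (f y)"
  shows "pdiam e (g ` S) \<le> pdiam d (f ` S)"
proof -
  have "ennreal (e (g x) (g y)) \<le> pdiam d (f ` S)" if "x \<in> S" "y \<in> S" for x y
  proof -
    have "ennreal (e (g x) (g y)) \<le> ennreal (d (f x) (f y))"
      by (rule ennreal_leI[OF assms])
    also have "\<dots> \<le> pdiam d (f ` S)"
      \<comment> \<open>Taking the bound to be the diameter itself makes reflexivity yield the
        estimate for each pair.\<close>
      using pdiam_le_iff[of d "f ` S" "pdiam d (f ` S)"] that by simp
    finally show ?thesis .
  qed
  then show ?thesis
    unfolding pdiam_le_iff by blast
qed

text \<open>The two hypotheses make \<open>d (f x) (f y)\<close> the least nonnegative upper bound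
  of the numbers \<open>e (g x) (g y)\<close>, so one open set serves both sides.\<close>

lemma fragmented_iff_family:
  assumes upper: "\<And>g x y. g \<in> F \<Longrightarrow> e (g x) (g y) \<le> d (f x) (f y)"
    and norming: "\<And>x y r. r \<ge> 0 \<Longrightarrow> (\<And>g. g \<in> F \<Longrightarrow> e (g x) (g y) \<le> r) \<Longrightarrow> d (f x) (f y) \<le> r"
  shows "fragmented X d f \<longleftrightarrow> fragmented_family X e F"
proof
  assume f: "fragmented X d f"
  show "fragmented_family X e F"
    unfolding fragmented_family_def
  proof (intro allI impI)
    fix A :: "'a set" and \<epsilon> :: real
    assume "A \<subseteq> topspace X \<and> A \<noteq> {} \<and> \<epsilon> > 0"
    then obtain U where U: "openin X U" "U \<inter> A \<noteq> {}"
      and small: "pdiam d (f ` (U \<inter> A)) < ennreal \<epsilon>"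
      using f[unfolded fragmented_def, rule_format, of A \<epsilon>] by blast
    have "pdiam e (g ` (U \<inter> A)) < ennreal \<epsilon>" if "g \<in> F" for g
      using pdiam_image_mono[where e = e and g = g and d = d and f = f, OF upper[OF that]] small
      by (rule le_less_trans)
    then show "\<exists>U. openin X U \<and> U \<inter> A \<noteq> {} \<and> (\<forall>g\<in>F. pdiam e (g ` (U \<inter> A)) < ennreal \<epsilon>)"
      using U by blast
  qed
next
  assume F: "fragmented_family X e F"
  show "fragmented X d f"
    unfolding fragmented_def
  proof (intro allI impI)
    fix A :: "'a set" and \<epsilon> :: real
    assume *: "A \<subseteq> topspace X \<and> A \<noteq> {} \<and> \<epsilon> > 0"
    then have "A \<subseteq> topspace X \<and> A \<noteq> {} \<and> \<epsilon> / 2 > 0" by simp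
    then obtain U where U: "openin X U" "U \<inter> A \<noteq> {}"
      and small: "\<And>g. g \<in> F \<Longrightarrow> pdiam e (g ` (U \<inter> A)) < ennreal (\<epsilon> / 2)"
      using F[unfolded fragmented_family_def, rule_format, of A "\<epsilon> / 2"] by blast
    have "e (g x) (g y) \<le> \<epsilon> / 2" if "g \<in> F" "x \<in> U \<inter> A" "y \<in> U \<inter> A" for g x y
    proof -
      have "ennreal (e (g x) (g y)) \<le> ennreal (\<epsilon> / 2)"
        using less_imp_le[OF small[OF that(1)]] that(2,3) unfolding pdiam_le_iff by blast
      \<comment> \<open>\<open>ennreal\<close> sends negative reals to 0, so returning to the reals
        relies on the bound \<epsilon>/2 being nonnegative.\<close>
      then show ?thesis using * by (simp add: ennreal_le_iff)
    qed
    then have "d (f x) (f y) \<le> \<epsilon> / 2" if "x \<in> U \<inter> A" "y \<in> U \<inter> A" for x y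
      using * that by (intro norming) auto
    then have "pdiam d (f ` (U \<inter> A)) \<le> ennreal (\<epsilon> / 2)"
      unfolding pdiam_le_iff by (blast intro: ennreal_leI)
    also have "\<dots> < ennreal \<epsilon>"
      using * by (simp add: ennreal_less_iff)
    finally show "\<exists>U. openin X U \<and> U \<inter> A \<noteq> {} \<and> pdiam d (f ` (U \<inter> A)) < ennreal \<epsilon>"
      using U by blast
  qed
qed

lemma norm_blinfun_le_cball:
  fixes x :: "('v::real_normed_vector) dual"
  assumes "r \<ge> 0" and "\<And>a. a \<in> cball 0 1 \<Longrightarrow> \<bar>blinfun_apply x a\<bar> \<le> r"
  shows "norm x \<le> r"
proof (rule norm_blinfun_bound[OF assms(1)])
  fix b
  show "norm (blinfun_apply x b) \<le> r * norm b"
  proof (cases "b = 0")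
    case False
    \<comment> \<open>Homogeneity: normalising \<open>b\<close> moves it into the unit ball.\<close>
    have "\<bar>blinfun_apply x (b /\<^sub>R norm b)\<bar> \<le> r"
      using False by (intro assms(2)) simp
    then show ?thesis
      using False by (simp add: blinfun.bilinear_simps abs_mult field_simps)
  qed simp
qed

lemma abs_blinfun_le_norm_cball:
  fixes x :: "('v::real_normed_vector) dual"
  assumes "a \<in> cball 0 1"
  shows "\<bar>blinfun_apply x a\<bar> \<le> norm x"
  using norm_blinfun[of x a] mult_left_mono[of "norm a" 1 "norm x"] assms by simp

text \<open>This is the canonical embedding of a space into its bidual.\<close>

definition eval_at :: "'v::real_normed_vector \<Rightarrow> 'v bidual" where
  "eval_at a = Blinfun (\<lambda>x. blinfun_apply x a)"

lemma eval_at_apply [simp]: "blinfun_apply (eval_at a) x = blinfun_apply x a"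
  unfolding eval_at_def
  by (simp add: bounded_linear_Blinfun_apply blinfun.bounded_linear_left)

lemma eval_at_cball: "a \<in> cball 0 1 \<Longrightarrow> eval_at a \<in> cball 0 1"
  using abs_blinfun_le_norm_cball[of a] by (auto intro!: norm_blinfun_bound)

text \<open>The metric on the target is the dual norm, hence a supremum of evaluations at points of
  the unit ball.\<close>

lemma fragmented_dual_iff_cball:
  fixes T :: "'x \<Rightarrow> ('v::real_normed_vector) dual"
  shows "fragmented X dist T \<longleftrightarrow>
    fragmented_family X dist ((\<lambda>a x. blinfun_apply (T x) a) ` cball 0 1)"
proof (rule fragmented_iff_family)
  fix g x y
  assume "g \<in> (\<lambda>a x. blinfun_apply (T x) a) ` cball 0 1"
  then show "dist (g x) (g y) \<le> dist (T x) (T y)"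
    using abs_blinfun_le_norm_cball[of _ "T x - T y"]
    by (auto simp: dist_norm blinfun.diff_left)
next
  fix x y and r :: real
  assume "r \<ge> 0"
    and r: "\<And>g. g \<in> (\<lambda>a x. blinfun_apply (T x) a) ` cball 0 1 \<Longrightarrow> dist (g x) (g y) \<le> r"
  show "dist (T x) (T y) \<le> r"
    unfolding dist_norm
  proof (rule norm_blinfun_le_cball[OF \<open>r \<ge> 0\<close>])
    fix a :: 'v
    assume "a \<in> cball 0 1"
    then show "\<bar>blinfun_apply (T x - T y) a\<bar> \<le> r"
      using r[OF imageI] by (simp add: dist_real_def blinfun.diff_left)
  qed
qed

text \<open>The hypothesis \<open>N\<close> isolates what both Arens products share: it turns the
  \<rho>-distance of \<open>N \<nu> x\<close> and \<open>N \<nu> y\<close> into the value of |\<nu>|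
  at \<open>T x - T y\<close>.\<close>

lemma fragmented_dual_iff_bidual_cball:
  fixes T :: "'x \<Rightarrow> ('v::real_normed_vector) dual"
  assumes N: "\<And>\<nu> x. blinfun_apply (N \<nu> x) \<phi> = blinfun_apply \<nu> (T x)"
  shows "fragmented X dist T \<longleftrightarrow> fragmented_family X (rho_dist \<phi>) (N ` cball 0 1)"
proof (rule fragmented_iff_family)
  have rho_dist_N: "rho_dist \<phi> (N \<nu> x) (N \<nu> y) = \<bar>blinfun_apply \<nu> (T x - T y)\<bar>" for \<nu> x y
    by (simp add: rho_dist_def rho_def blinfun.diff_left blinfun.diff_right N)
  \<comment> \<open>The block keeps \<open>rho_dist_N\<close> in scope across
    \<open>next\<close>.\<close>
  {
    fix g x y
    assume "g \<in> N ` cball 0 1"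
    then obtain \<nu> where \<nu>: "norm \<nu> \<le> 1" "g = N \<nu>" by auto
    have "\<bar>blinfun_apply \<nu> (T x - T y)\<bar> \<le> 1 * norm (T x - T y)"
      using norm_blinfun[of \<nu> "T x - T y"] mult_right_mono[OF \<nu>(1) norm_ge_zero[of "T x - T y"]]
      by simp
    then show "rho_dist \<phi> (g x) (g y) \<le> dist (T x) (T y)"
      by (simp add: \<nu>(2) rho_dist_N dist_norm)
  next
    fix x y and r :: real
    assume "r \<ge> 0" and r: "\<And>g. g \<in> N ` cball 0 1 \<Longrightarrow> rho_dist \<phi> (g x) (g y) \<le> r"
    show "dist (T x) (T y) \<le> r"
      unfolding dist_norm
    proof (rule norm_blinfun_le_cball[OF \<open>r \<ge> 0\<close>])
      fix a :: 'v
      assume "a \<in> cball 0 1"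
      \<comment> \<open>Among the functionals \<nu> in the bidual ball are the evaluations at points
        of the ball, and these already give the norm.\<close>
      then have "rho_dist \<phi> (N (eval_at a) x) (N (eval_at a) y) \<le> r"
        by (intro r imageI eval_at_cball)
      then show "\<bar>blinfun_apply (T x - T y) a\<bar> \<le> r"
        by (simp add: rho_dist_N)
    qed
  }
qed

theorem theorem4p3:
  fixes \<phi> :: "('a::{real_normed_algebra, banach}) dual"
  shows "(right_asplund \<phi> \<longleftrightarrow> fragmented weak_star_ball dist (orbit_l \<phi>)) \<and>
         (fragmented weak_star_ball dist (orbit_l \<phi>) \<longleftrightarrow>
            fragmented_family weak_star_ball (rho_dist \<phi>) (box_r ` cball 0 1)) \<and>
         (left_asplund \<phi> \<longleftrightarrow> fragmented weak_star_ball dist (orbit_r \<phi>)) \<and>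
         (fragmented weak_star_ball dist (orbit_r \<phi>) \<longleftrightarrow>
            fragmented_family weak_star_ball (rho_dist \<phi>) (diamond_l ` cball 0 1))"
proof (intro conjI)
  show "right_asplund \<phi> \<longleftrightarrow> fragmented weak_star_ball dist (orbit_l \<phi>)"
    \<comment> \<open>Evaluating the orbit map at \<open>a\<close> gives \<mu> applied to
      \<open>act_r \<phi> a\<close>, which is the family defining the Asplund property.\<close>
    by (simp add: right_asplund_iff fragmented_dual_iff_cball orbit_l_def)
  show "left_asplund \<phi> \<longleftrightarrow> fragmented weak_star_ball dist (orbit_r \<phi>)"
    by (simp add: left_asplund_iff fragmented_dual_iff_cball orbit_r_def)
  show "fragmented weak_star_ball dist (orbit_l \<phi>) \<longleftrightarrow>
      fragmented_family weak_star_ball (rho_dist \<phi>) (box_r ` cball 0 1)"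
    \<comment> \<open>By definition of the first Arens product, its value at \<phi> is \<nu> applied
      to the orbit of \<mu>.\<close>
    by (rule fragmented_dual_iff_bidual_cball) (simp add: box_r_def orbit_l_def)
  show "fragmented weak_star_ball dist (orbit_r \<phi>) \<longleftrightarrow>
      fragmented_family weak_star_ball (rho_dist \<phi>) (diamond_l ` cball 0 1)"
    by (rule fragmented_dual_iff_bidual_cball) (simp add: diamond_l_def orbit_r_def)
qed

end
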